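(* Let $G=(V,E)$ be a connected finite graph. Suppose that $h\in C(V)$ satisfies $h(x)\ge 0$ for all $x\in V$ and $h\not\equiv 0$. Then for any $\rho\in(-\infty,0)\cup(0,+\infty)$ and any $s\in(0,1)$, the mean field equation $$(-\Delta)^s u=\rho\left(\frac{he^u}{\int_V he^u d\mu}-\frac{1}{|V|}\right)\quad\text{for all } x\in V$$ has at least one solution $u\in\mathscr{M}$, where $\mathscr{M}=\{u\in W^{s,2}(V):\int_V he^u d\mu=1\}$.
   Context: Setting: $G=(V,E)$ is a finite graph (finite vertex set $V$, $n=\sharp V\ge 2$) that is simple (no loops or multiple edges), undirected and connected, with a positive vertex measure $\mu:V\to(0,+\infty)$ and positive symmetric edge weights $w_{xy}=w_{yx}>0$ for $xy\in E$. $C(V)$ is the set of all functions $V\to\mathbb{R}$; $\int_V u\,d\mu=\sum_{x\in V}\mu(x)u(x)$; $|V|=\sum_{x\in V}\mu(x)$. The Laplacian is $\Delta u(x)=\frac1{\mu(x)}\sum_{y\sim x}w_{xy}(u(y)-u(x))$. The eigenvalues of $-\Delta$ are $0=\lambda_0<\lambda_1\le\cdots\le\lambda_{n-1}$, with eigenfunctions $\phi_0,\dots,\phi_{n-1}$ orthonormal for $\langle u,v\rangle=\sum_{x\in V}\mu(x)u(x)v(x)$. For $s\in(0,1)$ and $x\ne y$ put $W_s(x,y)=-\mu(x)\mu(y)\sum_{i=0}^{n-1}\lambda_i^s\phi_i(x)\phi_i(y)$ (with $\lambda_0^s=0$); one has $0<W_s(x,y)=W_s(y,x)<+\infty$. The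 fractional Laplacian is $$(-\Delta)^s u(x)=\frac{1}{\mu(x)}\sum_{y\in V,\,y\ne x}W_s(x,y)(u(x)-u(y)),$$ and $|\nabla^s u|^2(x)=\frac{1}{2\mu(x)}\sum_{y\in V,\,y\neq x}W_s(x,y)(u(x)-u(y))^2$. $W^{s,2}(V)$ is the set of $u\in C(V)$ with $\int_V(|\nabla^s u|^2+|u|^2)d\mu<+\infty$; since $V$ is finite, $W^{s,2}(V)=C(V)$. *)

theory Defs
  imports "HOL-Analysis.Analysis" "Graph_Theory.Graph_Theory"
begin

text \<open>
  A graph is a \<^locale>\<open>pair_graph\<close>: finite vertex set, no loops, and a symmetric set of ordered
  pairs as arcs, so that each undirected edge occurs once in either direction. Functions in C(V)
  are total functions on the vertex type; no definition below looks at their values outside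
  the vertex set.
\<close>

locale weighted_graph = pair_graph G for G :: "'a pair_pre_digraph" +
  fixes \<mu> :: "'a \<Rightarrow> real" and w :: "'a \<Rightarrow> 'a \<Rightarrow> real"
  assumes connected_graph: "Digraph_Component.connected (with_proj G)"
    and card_verts: "card (pverts G) \<ge> 2"
    and measure_pos: "x \<in> pverts G \<Longrightarrow> \<mu> x > 0"
    and weight_pos: "(x, y) \<in> parcs G \<Longrightarrow> w x y > 0"
    and weight_sym: "(x, y) \<in> parcs G \<Longrightarrow> w x y = w y x"

definition vint :: "'a pair_pre_digraph \<Rightarrow> ('a \<Rightarrow> real) \<Rightarrow> ('a \<Rightarrow> real) \<Rightarrow> real" where
  "vint G \<mu> u = (\<Sum>x\<in>pverts G. \<mu> x * u x)"

definition vol :: "'a pair_pre_digraph \<Rightarrow> ('a \<Rightarrow> real) \<Rightarrow> real" where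
  "vol G \<mu> = (\<Sum>x\<in>pverts G. \<mu> x)"

definition vinner ::
  "'a pair_pre_digraph \<Rightarrow> ('a \<Rightarrow> real) \<Rightarrow> ('a \<Rightarrow> real) \<Rightarrow> ('a \<Rightarrow> real) \<Rightarrow> real" where
  "vinner G \<mu> u v = (\<Sum>x\<in>pverts G. \<mu> x * u x * v x)"

definition laplacian ::
  "'a pair_pre_digraph \<Rightarrow> ('a \<Rightarrow> real) \<Rightarrow> ('a \<Rightarrow> 'a \<Rightarrow> real) \<Rightarrow> ('a \<Rightarrow> real) \<Rightarrow> 'a \<Rightarrow> real" where
  "laplacian G \<mu> w u x = 1 / \<mu> x * (\<Sum>y | (x, y) \<in> parcs G. w x y * (u y - u x))"

text \<open>
  A complete orthonormal system of eigenfunctions of minus the Laplacian, with the eigenvalues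
  (counted with multiplicity) in nondecreasing order. Such a system always exists, and
  \<open>lam 0 = 0 < lam 1\<close> holds automatically; both facts are proved at the end of this theory.
\<close>

definition eigensystem ::
  "'a pair_pre_digraph \<Rightarrow> ('a \<Rightarrow> real) \<Rightarrow> ('a \<Rightarrow> 'a \<Rightarrow> real) \<Rightarrow>
     (nat \<Rightarrow> real) \<Rightarrow> (nat \<Rightarrow> 'a \<Rightarrow> real) \<Rightarrow> bool" where
  "eigensystem G \<mu> w lam \<phi> \<longleftrightarrow>
     (\<forall>i<card (pverts G). \<forall>x\<in>pverts G. - laplacian G \<mu> w (\<phi> i) x = lam i * \<phi> i x) \<and>
     (\<forall>i<card (pverts G). \<forall>j<card (pverts G).
        vinner G \<mu> (\<phi> i) (\<phi> j) = (if i = j then 1 else 0)) \<and>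
     (\<forall>i j. i \<le> j \<longrightarrow> j < card (pverts G) \<longrightarrow> lam i \<le> lam j)"

text \<open>The convention \<open>lam\<^sub>0\<^sup>s = 0\<close> is built into \<open>powr\<close>, since \<open>0 powr s = 0\<close>.\<close>

definition frac_weight ::
  "'a pair_pre_digraph \<Rightarrow> ('a \<Rightarrow> real) \<Rightarrow> (nat \<Rightarrow> real) \<Rightarrow> (nat \<Rightarrow> 'a \<Rightarrow> real) \<Rightarrow>
     real \<Rightarrow> 'a \<Rightarrow> 'a \<Rightarrow> real" where
  "frac_weight G \<mu> lam \<phi> s x y =
     - \<mu> x * \<mu> y * (\<Sum>i<card (pverts G). lam i powr s * \<phi> i x * \<phi> i y)"

definition frac_laplacian ::
  "'a pair_pre_digraph \<Rightarrow> ('a \<Rightarrow> real) \<Rightarrow> (nat \<Rightarrow> real) \<Rightarrow> (nat \<Rightarrow> 'a \<Rightarrow> real) \<Rightarrow>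
     real \<Rightarrow> ('a \<Rightarrow> real) \<Rightarrow> 'a \<Rightarrow> real" where
  "frac_laplacian G \<mu> lam \<phi> s u x =
     1 / \<mu> x * (\<Sum>y\<in>pverts G - {x}. frac_weight G \<mu> lam \<phi> s x y * (u x - u y))"

definition frac_grad_sq ::
  "'a pair_pre_digraph \<Rightarrow> ('a \<Rightarrow> real) \<Rightarrow> (nat \<Rightarrow> real) \<Rightarrow> (nat \<Rightarrow> 'a \<Rightarrow> real) \<Rightarrow>
     real \<Rightarrow> ('a \<Rightarrow> real) \<Rightarrow> 'a \<Rightarrow> real" where
  "frac_grad_sq G \<mu> lam \<phi> s u x =
     1 / (2 * \<mu> x) * (\<Sum>y\<in>pverts G - {x}. frac_weight G \<mu> lam \<phi> s x y * (u x - u y)\<^sup>2)"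

text \<open>
  The integral is a finite sum of reals, so the finiteness condition always holds and this space
  is all of C(V).
\<close>

definition frac_sobolev ::
  "'a pair_pre_digraph \<Rightarrow> ('a \<Rightarrow> real) \<Rightarrow> (nat \<Rightarrow> real) \<Rightarrow> (nat \<Rightarrow> 'a \<Rightarrow> real) \<Rightarrow>
     real \<Rightarrow> ('a \<Rightarrow> real) set" where
  "frac_sobolev G \<mu> lam \<phi> s =
     {u. ereal (vint G \<mu> (\<lambda>x. frac_grad_sq G \<mu> lam \<phi> s u x + \<bar>u x\<bar>\<^sup>2)) < \<infinity>}"

definition mean_field_space ::
  "'a pair_pre_digraph \<Rightarrow> ('a \<Rightarrow> real) \<Rightarrow> (nat \<Rightarrow> real) \<Rightarrow> (nat \<Rightarrow> 'a \<Rightarrow> real) \<Rightarrow>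
     real \<Rightarrow> ('a \<Rightarrow> real) \<Rightarrow> ('a \<Rightarrow> real) set" where
  "mean_field_space G \<mu> lam \<phi> s h =
     {u \<in> frac_sobolev G \<mu> lam \<phi> s. vint G \<mu> (\<lambda>x. h x * exp (u x)) = 1}"


section \<open>Existence of eigensystems\<close>

context weighted_graph
begin

abbreviation "V \<equiv> pverts G"
abbreviation ip where "ip \<equiv> vinner G \<mu>"
abbreviation L where "L u x \<equiv> - laplacian G \<mu> w u x"

lemma finV [simp]: "finite V"
  by (rule pair_finite_verts)

lemma ip_sym: "ip u v = ip v u"
  by (simp add: vinner_def mult_ac)

lemma ip_diff: "ip (\<lambda>x. u x - v x) z = ip u z - ip v z"
  by (simp add: vinner_def algebra_simps sum_subtractf)

lemma ip_add: "ip (\<lambda>x. u x + v x) z = ip u z + ip v z"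
  by (simp add: vinner_def algebra_simps sum.distrib)

lemma ip_scale: "ip (\<lambda>x. c * u x) z = c * ip u z"
  by (simp add: vinner_def algebra_simps sum_distrib_left)

lemma ip_sum: "ip (\<lambda>x. \<Sum>i\<in>I. u i x) z = (\<Sum>i\<in>I. ip (u i) z)"
  unfolding vinner_def sum_distrib_left sum_distrib_right by (rule sum.swap)

lemma ip_delta: "x \<in> V \<Longrightarrow> ip (\<lambda>y. if y = x then 1 else 0) u = \<mu> x * u x"
proof -
  assume x: "x \<in> V"
  have "ip (\<lambda>y. if y = x then 1 else 0) u = (\<Sum>y\<in>V. if y = x then \<mu> x * u x else 0)"
    unfolding vinner_def by (intro sum.cong refl) simp
  then show ?thesis using x by simp
qed

lemma ip_nonneg: "ip u u \<ge> 0"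
  unfolding vinner_def mult.assoc
proof (rule sum_nonneg)
  fix x assume "x \<in> V"
  then show "0 \<le> \<mu> x * (u x * u x)"
    using measure_pos[of x] by simp
qed

lemma ip_eq_0:
  assumes "ip u u = 0" "x \<in> V"
  shows "u x = 0"
proof -
  have "\<forall>y\<in>V. \<mu> y * (u y * u y) = 0"
  proof (subst sum_nonneg_eq_0_iff[symmetric])
    fix y assume "y \<in> V"
    then show "0 \<le> \<mu> y * (u y * u y)"
      by (intro mult_nonneg_nonneg less_imp_le[OF measure_pos] zero_le_square)
  qed (use assms(1) in \<open>simp_all add: vinner_def mult.assoc\<close>)
  then show ?thesis using assms(2) measure_pos[OF assms(2)] by auto
qed

lemma ip_cong: "(\<And>x. x \<in> V \<Longrightarrow> u x = u' x) \<Longrightarrow> (\<And>x. x \<in> V \<Longrightarrow> v x = v' x) \<Longrightarrow> ip u v = ip u' v'"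
  unfolding vinner_def by (rule sum.cong) auto

definition aw where "aw x y = (if (x, y) \<in> parcs G then w x y else 0)"

lemma aw_sym: "aw x y = aw y x"
  using weight_sym arcs_symmetric by (auto simp: aw_def)

lemma aw_nonneg: "aw x y \<ge> 0"
  using weight_pos by (force simp: aw_def)

lemma aw_sq_nonneg: "aw x y * c * c \<ge> 0"
  unfolding mult.assoc by (rule mult_nonneg_nonneg[OF aw_nonneg zero_le_square])

lemma laplacian_eq:
  "x \<in> V \<Longrightarrow> \<mu> x * L u x = (\<Sum>y\<in>V. aw x y * (u x - u y))"
proof -
  assume x: "x \<in> V"
  have "(\<Sum>y\<in>V. aw x y * (u x - u y)) = (\<Sum>y | (x, y) \<in> parcs G. aw x y * (u x - u y))"
    by (rule sum.mono_neutral_right) (auto simp: aw_def dest: in_arcsD2)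
  also have "\<dots> = - (\<Sum>y | (x, y) \<in> parcs G. w x y * (u y - u x))"
    unfolding sum_negf[symmetric] by (rule sum.cong) (auto simp: aw_def algebra_simps)
  finally show ?thesis
    using measure_pos[OF x] by (simp add: laplacian_def)
qed

lemma green: "ip (L u) v = (\<Sum>x\<in>V. \<Sum>y\<in>V. aw x y * (u x - u y) * (v x - v y)) / 2"
proof -
  have 1: "ip (L u) v = (\<Sum>x\<in>V. \<Sum>y\<in>V. aw x y * (u x - u y) * v x)"
    unfolding vinner_def
    by (rule sum.cong[OF refl]) (subst laplacian_eq, auto simp: sum_distrib_right)
  also have "\<dots> = (\<Sum>y\<in>V. \<Sum>x\<in>V. aw x y * (u x - u y) * v x)"
    by (rule sum.swap)
  also have "\<dots> = (\<Sum>x\<in>V. \<Sum>y\<in>V. - (aw x y * (u x - u y) * v y))"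
    by (intro sum.cong refl) (simp add: aw_sym algebra_simps)
  finally have 2: "ip (L u) v = \<dots>" .
  have "2 * ip (L u) v
      = (\<Sum>x\<in>V. \<Sum>y\<in>V. aw x y * (u x - u y) * v x) + (\<Sum>x\<in>V. \<Sum>y\<in>V. - (aw x y * (u x - u y) * v y))"
    using 1 2 by simp
  also have "\<dots> = (\<Sum>x\<in>V. \<Sum>y\<in>V. aw x y * (u x - u y) * (v x - v y))"
    unfolding sum.distrib[symmetric] by (intro sum.cong refl) (simp add: algebra_simps)
  finally show ?thesis by simp
qed

lemma L_sym: "ip (L u) v = ip u (L v)"
proof -
  have "ip (L u) v = ip (L v) u" unfolding green by (simp add: mult_ac)
  then show ?thesis by (simp add: ip_sym)
qed

lemma L_nonneg: "ip (L u) u \<ge> 0"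
  unfolding green by (simp add: sum_nonneg aw_sq_nonneg)

lemma L_add_scale: "x \<in> V \<Longrightarrow> L (\<lambda>y. u y + t * v y) x = L u x + t * L v x"
proof -
  assume x: "x \<in> V"
  have "\<mu> x * L (\<lambda>y. u y + t * v y) x = \<mu> x * L u x + t * (\<mu> x * L v x)"
    unfolding laplacian_eq[OF x] sum_distrib_left sum.distrib[symmetric]
    by (intro sum.cong refl) (simp add: algebra_simps)
  then have "\<mu> x * L (\<lambda>y. u y + t * v y) x = \<mu> x * (L u x + t * L v x)"
    by (simp only: distrib_left mult.left_commute)
  then show ?thesis
    using measure_pos[OF x] by (metis mult_cancel_left less_irrefl)
qed

definition orthon where
  "orthon k \<phi> \<longleftrightarrow> (\<forall>i<k. \<forall>j<k. ip (\<phi> i) (\<phi> j) = (if i = j then 1 else (0::real)))"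

definition res where
  "res k \<phi> x = (\<lambda>y. (if y = x then 1 else 0) - (\<Sum>i<k. \<mu> x * \<phi> i x * \<phi> i y))"

lemma res_orth:
  fixes k :: nat
  assumes "orthon k \<phi>" "x \<in> V" "j < k"
  shows "ip (res k \<phi> x) (\<phi> j) = 0"
proof -
  have "ip (res k \<phi> x) (\<phi> j) = \<mu> x * \<phi> j x - (\<Sum>i<k. \<mu> x * \<phi> i x * ip (\<phi> i) (\<phi> j))"
    unfolding res_def ip_diff ip_sum ip_scale using assms by (simp add: ip_delta)
  also have "(\<Sum>i<k. \<mu> x * \<phi> i x * ip (\<phi> i) (\<phi> j)) = (\<Sum>i<k. if i = j then \<mu> x * \<phi> i x else 0)"
    using assms by (intro sum.cong refl) (auto simp: orthon_def)
  finally show ?thesis using assms by simp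
qed

lemma res_norm:
  fixes k :: nat
  assumes "orthon k \<phi>" "x \<in> V"
  shows "ip (res k \<phi> x) (res k \<phi> x) = \<mu> x * res k \<phi> x x"
proof -
  have "ip (res k \<phi> x) (res k \<phi> x)
      = \<mu> x * res k \<phi> x x - (\<Sum>i<k. \<mu> x * \<phi> i x * ip (\<phi> i) (res k \<phi> x))"
    using assms
    by (subst (1) res_def) (simp add: ip_diff ip_sum ip_scale ip_delta)
  also have "(\<Sum>i<k. \<mu> x * \<phi> i x * ip (\<phi> i) (res k \<phi> x)) = 0"
    using res_orth[OF assms] by (intro sum.neutral) (auto simp: ip_sym)
  finally show ?thesis by simp
qed

lemma res_trace:
  fixes k :: nat
  assumes "orthon k \<phi>"
  shows "(\<Sum>x\<in>V. res k \<phi> x x) = real (card V) - real k"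
proof -
  have "(\<Sum>x\<in>V. res k \<phi> x x) = real (card V) - (\<Sum>x\<in>V. \<Sum>i<k. \<mu> x * \<phi> i x * \<phi> i x)"
    by (simp add: res_def sum_subtractf)
  also have "(\<Sum>x\<in>V. \<Sum>i<k. \<mu> x * \<phi> i x * \<phi> i x) = (\<Sum>i<k. ip (\<phi> i) (\<phi> i))"
    unfolding vinner_def by (rule sum.swap)
  also have "\<dots> = real k"
    using assms by (simp add: orthon_def)
  finally show ?thesis .
qed

lemma orth_complement_nontrivial:
  fixes k :: nat
  assumes "orthon k \<phi>" "k < card V"
  obtains u where "ip u u > 0" "\<forall>j<k. ip u (\<phi> j) = 0"
proof -
  have "(\<Sum>x\<in>V. res k \<phi> x x) \<noteq> 0"
    unfolding res_trace[OF assms(1)] using assms(2) by simp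
  then have "\<exists>x\<in>V. res k \<phi> x x \<noteq> 0"
    by (rule contrapos_np) (rule sum.neutral, simp)
  then obtain x where x: "x \<in> V" "res k \<phi> x x \<noteq> 0" by blast
  then have "ip (res k \<phi> x) (res k \<phi> x) \<noteq> 0" using ip_eq_0 by blast
  then have "ip (res k \<phi> x) (res k \<phi> x) > 0" using ip_nonneg by (simp add: less_le)
  with res_orth[OF assms(1) x(1)] show ?thesis using that by blast
qed

lemma orthon_complete:
  assumes "orthon (card V) \<phi>" "\<forall>j<card V. ip u (\<phi> j) = 0" "x \<in> V"
  shows "u x = 0"
proof -
  let ?k = "card V"
  have nn: "res ?k \<phi> z z \<ge> 0" if "z \<in> V" for z
    using res_norm[OF assms(1) that] ip_nonneg[of "res ?k \<phi> z"] measure_pos[OF that]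
    by (simp add: zero_le_mult_iff)
  have "res ?k \<phi> x x = 0"
    using res_trace[OF assms(1)] sum_nonneg_eq_0_iff[of V "\<lambda>z. res ?k \<phi> z z"] nn assms(3) by auto
  then have "ip (res ?k \<phi> x) (res ?k \<phi> x) = 0" using res_norm[OF assms(1,3)] by simp
  then have z: "res ?k \<phi> x y = 0" if "y \<in> V" for y using ip_eq_0 that by blast
  have "0 = ip (res ?k \<phi> x) u"
    unfolding vinner_def using z by simp
  also have "\<dots> = \<mu> x * u x - (\<Sum>i<?k. \<mu> x * \<phi> i x * ip (\<phi> i) u)"
    unfolding res_def ip_diff ip_sum ip_scale using assms by (simp add: ip_delta)
  also have "\<dots> = \<mu> x * u x"
    using assms(2) by (simp add: ip_sym)
  finally show ?thesis using measure_pos[OF assms(3)] by simp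
qed

lemma minimizer:
  fixes k :: nat
  assumes "orthon k \<phi>" "k < card V"
  obtains f where "ip f f = 1" "\<forall>j<k. ip f (\<phi> j) = 0"
    "\<And>u. \<forall>j<k. ip u (\<phi> j) = 0 \<Longrightarrow> ip (L f) f * ip u u \<le> ip (L u) u"
proof -
  define B where "B x = (if x \<in> V then {-(1 / sqrt (\<mu> x))..1 / sqrt (\<mu> x)} else {0::real})" for x
  define K where "K = PiE UNIV B"
  define S where "S = K \<inter> {u. ip u u = 1} \<inter> (\<Inter>j\<in>{..<k}. {u. ip u (\<phi> j) = 0})"
  have contip: "continuous_on UNIV (\<lambda>u. ip u v)" for v
    unfolding vinner_def by (intro continuous_intros) simp
  have contip2: "continuous_on UNIV (\<lambda>u. ip u u)"
    unfolding vinner_def by (intro continuous_intros) simp_all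
  have contQ: "continuous_on UNIV (\<lambda>u. ip (L u) u)"
    unfolding green by (intro continuous_intros) simp_all
  have "compactin (product_topology (\<lambda>i. euclidean) UNIV) K"
    unfolding K_def compactin_PiE by (auto simp: B_def)
  then have "compact K" by (simp add: euclidean_product_topology)
  moreover have "closed {u. ip u u = 1}"
    by (rule closed_Collect_eq[OF contip2]) simp
  moreover have "closed (\<Inter>j\<in>{..<k}. {u. ip u (\<phi> j) = 0})"
    by (intro closed_INT ballI closed_Collect_eq contip) simp
  ultimately have cS: "compact S"
    unfolding S_def by (intro compact_Int_closed)
  define nrm where "nrm u = (\<lambda>x. if x \<in> V then (1 / sqrt (ip u u)) * u x else 0)" for u
  have ipn: "ip (nrm u) v = (1 / sqrt (ip u u)) * ip u v" for u v
    by (subst ip_scale[symmetric]) (rule ip_cong, auto simp: nrm_def)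
  have ipnn: "ip (nrm u) (nrm u) = 1" if "ip u u > 0" for u
    using that by (subst ipn, subst ip_sym, subst ipn) (simp add: field_simps)
  have nS: "nrm u \<in> S" if "ip u u > 0" "\<forall>j<k. ip u (\<phi> j) = 0" for u
  proof -
    have "nrm u x \<in> B x" for x
    proof (cases "x \<in> V")
      case True
      have "\<mu> x * nrm u x * nrm u x \<le> ip (nrm u) (nrm u)"
        unfolding vinner_def
        by (rule member_le_sum[OF True]) (auto simp: mult.assoc less_imp_le measure_pos)
      then have "(nrm u x)\<^sup>2 \<le> 1 / \<mu> x"
        using measure_pos[OF True] that by (simp add: ipnn field_simps power2_eq_square)
      then have "\<bar>nrm u x\<bar> \<le> sqrt (1 / \<mu> x)"
        using real_le_rsqrt[of "\<bar>nrm u x\<bar>"] by simp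
      then show ?thesis using True by (auto simp: B_def real_sqrt_divide abs_le_iff)
    qed (simp add: nrm_def B_def)
    moreover have "\<forall>j<k. ip (nrm u) (\<phi> j) = 0" using that(2) by (simp add: ipn)
    ultimately show ?thesis using ipnn[OF that(1)] by (simp add: S_def K_def PiE_def)
  qed
  obtain u0 where "ip u0 u0 > 0" "\<forall>j<k. ip u0 (\<phi> j) = 0"
    using orth_complement_nontrivial[OF assms] by blast
  then have "S \<noteq> {}" using nS by blast
  then obtain f where f: "f \<in> S" "\<forall>u\<in>S. ip (L f) f \<le> ip (L u) u"
    using continuous_attains_inf[OF cS _ continuous_on_subset[OF contQ subset_UNIV]] by blast
  show ?thesis
  proof (rule that)
    show "ip f f = 1" "\<forall>j<k. ip f (\<phi> j) = 0" using f(1) by (auto simp: S_def)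
    fix u assume u: "\<forall>j<k. ip u (\<phi> j) = 0"
    show "ip (L f) f * ip u u \<le> ip (L u) u"
    proof (cases "ip u u = 0")
      case True
      then show ?thesis using L_nonneg[of u] by simp
    next
      case False
      then have p: "ip u u > 0" using ip_nonneg[of u] by simp
      have "ip (L (nrm u)) (nrm u) = (\<Sum>x\<in>V. \<Sum>y\<in>V. (1 / ip u u) * (aw x y * (u x - u y) * (u x - u y))) / 2"
        unfolding green
      proof (intro arg_cong2[of _ _ _ _ "(/)"] sum.cong refl)
        fix x y assume xy: "x \<in> V" "y \<in> V"
        have e: "nrm u x - nrm u y = (1 / sqrt (ip u u)) * (u x - u y)"
          using xy by (simp add: nrm_def diff_divide_distrib)
        show "aw x y * (nrm u x - nrm u y) * (nrm u x - nrm u y)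
            = (1 / ip u u) * (aw x y * (u x - u y) * (u x - u y))"
          unfolding e using p by (simp add: field_simps)
      qed
      also have "\<dots> = ip (L u) u / ip u u"
        unfolding green by (simp add: sum_divide_distrib mult.commute)
      finally have "ip (L f) f \<le> ip (L u) u / ip u u"
        using f(2) nS[OF p u] by metis
      then show ?thesis using p by (simp add: field_simps)
    qed
  qed
qed

lemma quadratic_min_zero:
  fixes a b :: real
  assumes "\<And>t. 0 \<le> 2 * t * a + t\<^sup>2 * b" "b \<ge> 0"
  shows "a = 0"
proof -
  define d where "d = 1 / (b + 1)"
  have d: "d > 0" and db: "d * b = 1 - d"
    using assms(2) by (simp_all add: d_def field_simps)
  have "0 \<le> 2 * (- d * a) * a + (- d * a)\<^sup>2 * b" by (rule assms)
  also have "\<dots> = - 2 * d * a\<^sup>2 + d * a\<^sup>2 * (d * b)"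
    by (simp add: power2_eq_square)
  also have "\<dots> = - (d * a\<^sup>2) - (d * a)\<^sup>2"
    unfolding db by (simp add: power2_eq_square algebra_simps)
  finally have "d * a\<^sup>2 + (d * a)\<^sup>2 \<le> 0" by simp
  then have "d * a\<^sup>2 \<le> 0"
    using zero_le_power2[of "d * a"] by linarith
  then show ?thesis using d by (simp add: mult_le_0_iff)
qed

lemma eigensystem_aux:
  "k \<le> card V \<Longrightarrow> \<exists>lam \<phi>. orthon k \<phi> \<and>
     (\<forall>i<k. \<forall>x\<in>V. L (\<phi> i) x = lam i * \<phi> i x) \<and>
     (\<forall>i<k. \<forall>u. (\<forall>j<i. ip u (\<phi> j) = 0) \<longrightarrow> lam i * ip u u \<le> ip (L u) u)"
proof (induction k)
  case 0
  show ?case by (simp add: orthon_def)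
next
  case (Suc k)
  then obtain lam :: "nat \<Rightarrow> real" and \<phi> where IH: "orthon k \<phi>" "\<forall>i<k. \<forall>x\<in>V. L (\<phi> i) x = lam i * \<phi> i x"
    "\<forall>i<k. \<forall>u. (\<forall>j<i. ip u (\<phi> j) = 0) \<longrightarrow> lam i * ip u u \<le> ip (L u) u"
    by auto
  obtain f where f: "ip f f = 1" "\<forall>j<k. ip f (\<phi> j) = 0"
    "\<And>u. \<forall>j<k. ip u (\<phi> j) = 0 \<Longrightarrow> ip (L f) f * ip u u \<le> ip (L u) u"
    using minimizer[OF IH(1)] Suc.prems by auto
  define l where "l = ip (L f) f"
  define g where "g = (\<lambda>x. L f x - l * f x)"
  have gorth: "\<forall>j<k. ip g (\<phi> j) = 0"
  proof (intro allI impI)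
    fix j assume j: "j < k"
    have "ip (L f) (\<phi> j) = ip f (\<lambda>x. lam j * \<phi> j x)"
      unfolding L_sym by (rule ip_cong) (use IH(2) j in auto)
    also have "\<dots> = lam j * ip f (\<phi> j)"
      by (subst ip_sym, subst ip_scale, subst ip_sym) (rule refl)
    also have "\<dots> = 0" using f(2) j by simp
    finally show "ip g (\<phi> j) = 0" unfolding g_def ip_diff ip_scale using f(2) j by simp
  qed
  have ipadd2: "ip (\<lambda>x. a x + t * b x) (\<lambda>x. c x + t * d x)
      = ip a c + t * (ip a d + ip b c) + t\<^sup>2 * ip b d" for a b c d t
    by (simp add: vinner_def sum_distrib_left sum.distrib[symmetric] power2_eq_square
        algebra_simps)
  have "ip (L f) g - l * ip f g = 0"
  proof (rule quadratic_min_zero)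
    fix t :: real
    let ?u = "\<lambda>x. f x + t * g x"
    have "\<forall>j<k. ip ?u (\<phi> j) = 0" using f(2) gorth by (simp add: ip_add ip_scale)
    then have "l * ip ?u ?u \<le> ip (L ?u) ?u" unfolding l_def by (rule f(3))
    also have "ip (L ?u) ?u = ip (\<lambda>x. L f x + t * L g x) ?u"
      by (rule ip_cong) (simp_all only: L_add_scale)
    finally have "l * ip ?u ?u \<le> ip (\<lambda>x. L f x + t * L g x) ?u" .
    then have "l * (1 + t * (2 * ip f g) + t\<^sup>2 * ip g g)
        \<le> l + t * (2 * ip (L f) g) + t\<^sup>2 * ip (L g) g"
      unfolding ipadd2 f(1) ip_sym[of g f] L_sym[of g f] ip_sym[of g "L f"] l_def[symmetric]
      by simp
    then show "0 \<le> 2 * t * (ip (L f) g - l * ip f g) + t\<^sup>2 * (ip (L g) g - l * ip g g)"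
      by (simp add: algebra_simps)
  next
    show "0 \<le> ip (L g) g - l * ip g g" using f(3)[OF gorth] by (simp add: l_def)
  qed
  then have "ip g g = 0"
    by (subst g_def) (simp add: ip_diff ip_scale)
  then have ev: "L f x = l * f x" if "x \<in> V" for x
    using ip_eq_0[OF _ that, of g] by (simp add: g_def)
  let ?l = "\<lambda>i. if i = k then l else lam i" and ?p = "\<lambda>i. if i = k then f else \<phi> i"
  have "orthon (Suc k) ?p"
    unfolding orthon_def
  proof (intro allI impI)
    fix i j assume "i < Suc k" "j < Suc k"
    then consider "i < k" "j < k" | "i = k" "j < k" | "i < k" "j = k" | "i = k" "j = k" by linarith
    then show "ip (?p i) (?p j) = (if i = j then 1 else 0)"
      using IH(1) f(1,2) by cases (auto simp: orthon_def ip_sym[of "\<phi> _" f])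
  qed
  moreover have "\<forall>i<Suc k. \<forall>x\<in>V. L (?p i) x = ?l i * ?p i x"
    using IH(2) ev by (auto simp: less_Suc_eq)
  moreover have "\<forall>i<Suc k. \<forall>u. (\<forall>j<i. ip u (?p j) = 0) \<longrightarrow> ?l i * ip u u \<le> ip (L u) u"
    using IH(3) f(3) by (auto simp: less_Suc_eq l_def)
  ultimately show ?case by (intro exI[of _ ?l] exI[of _ ?p] conjI)
qed

theorem eigensystem_exists: "\<exists>lam \<phi>. eigensystem G \<mu> w lam \<phi>"
proof -
  obtain lam :: "nat \<Rightarrow> real" and \<phi> where a: "orthon (card V) \<phi>"
    "\<forall>i<card V. \<forall>x\<in>V. L (\<phi> i) x = lam i * \<phi> i x"
    "\<forall>i<card V. \<forall>u. (\<forall>j<i. ip u (\<phi> j) = 0) \<longrightarrow> lam i * ip u u \<le> ip (L u) u"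
    using eigensystem_aux[OF order_refl] by blast
  have "lam i \<le> lam j" if ij: "i \<le> j" "j < card V" for i j
  proof -
    have "\<forall>m<i. ip (\<phi> j) (\<phi> m) = 0" using a(1) ij by (auto simp: orthon_def)
    then have "lam i * ip (\<phi> j) (\<phi> j) \<le> ip (L (\<phi> j)) (\<phi> j)" using a(3) ij by simp
    also have "\<dots> = ip (\<lambda>x. lam j * \<phi> j x) (\<phi> j)"
      by (rule ip_cong) (use a(2) ij in auto)
    finally show ?thesis using a(1) ij by (simp add: ip_scale orthon_def)
  qed
  then have "eigensystem G \<mu> w lam \<phi>"
    unfolding eigensystem_def using a(1,2) by (auto simp: orthon_def)
  then show ?thesis by blast
qed

lemma harmonic_constant:
  assumes "ip (L u) u = 0" "x \<in> V" "y \<in> V"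
  shows "u x = u y"
proof -
  have arc: "u a = u b" if ab: "(a, b) \<in> parcs G" for a b
  proof -
    have V: "a \<in> V" "b \<in> V" using ab in_arcsD1 in_arcsD2 by auto
    have "(\<Sum>x\<in>V. \<Sum>y\<in>V. aw x y * (u x - u y) * (u x - u y)) = 0"
      using assms(1) unfolding green by simp
    then have "(\<Sum>y\<in>V. aw a y * (u a - u y) * (u a - u y)) = 0"
      using sum_nonneg_0[OF finV _ _ V(1), of "\<lambda>x. \<Sum>y\<in>V. aw x y * (u x - u y) * (u x - u y)"]
      by (simp add: sum_nonneg aw_sq_nonneg)
    then have "aw a b * (u a - u b) * (u a - u b) = 0"
      using sum_nonneg_0[OF finV _ _ V(2), of "\<lambda>y. aw a y * (u a - u y) * (u a - u y)"]
      by (simp add: aw_sq_nonneg)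
    then show ?thesis using weight_pos[OF ab] ab by (simp add: aw_def)
  qed
  have "x \<rightarrow>\<^sup>*\<^bsub>mk_symmetric (with_proj G)\<^esub> y"
    using connected_graph assms(2,3) unfolding Digraph_Component.connected_def strongly_connected_def
    by simp
  then have "(x, y) \<in> rtrancl_on (pverts G) (parcs G)"
    unfolding reachable_mk_symmetric_eq[OF pair_sym_arcs] by (simp add: reachable_def)
  then show ?thesis
    by (induction rule: rtrancl_on_induct) (auto simp: arc)
qed

theorem eigensystem_spectrum:
  assumes "eigensystem G \<mu> w lam \<phi>"
  shows "lam 0 = 0" and "lam 1 > 0"
proof -
  have on: "orthon (card V) \<phi>" using assms by (auto simp: eigensystem_def orthon_def)
  have Q: "ip (L (\<phi> i)) v = lam i * ip (\<phi> i) v" if "i < card V" for i v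
    unfolding ip_scale[symmetric] by (rule ip_cong) (use assms that in \<open>auto simp: eigensystem_def\<close>)
  have nn: "lam i \<ge> 0" if "i < card V" for i
    using L_nonneg[of "\<phi> i"] Q[OF that, of "\<phi> i"] on that by (simp add: orthon_def)
  have c: "card V > 1" using card_verts by simp
  then obtain x where x: "x \<in> V" by (metis card.empty equals0I not_less_zero)
  show l0: "lam 0 = 0"
  proof (rule ccontr)
    assume n0: "lam 0 \<noteq> 0"
    have "ip (\<lambda>_. 1) (\<phi> i) = 0" if i: "i < card V" for i
    proof -
      have "lam 0 \<le> lam i" using assms i by (simp add: eigensystem_def)
      then have "lam i > 0" using n0 nn[of 0] c by auto
      moreover have "lam i * ip (\<phi> i) (\<lambda>_. 1) = 0"
        unfolding Q[OF i, symmetric] green by simp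
      ultimately show ?thesis by (simp add: ip_sym)
    qed
    then show False using orthon_complete[OF on, of "\<lambda>_. 1" x] x by simp
  qed
  show "lam 1 > 0"
  proof (rule ccontr)
    assume "\<not> lam 1 > 0"
    then have l1: "lam 1 = 0" using nn[OF c] by simp
    have c0: "\<phi> 0 y = \<phi> 0 x" if "y \<in> V" for y
      by (rule harmonic_constant[OF _ that x]) (use Q[of 0] l0 c in simp)
    have c1: "\<phi> 1 y = \<phi> 1 x" if "y \<in> V" for y
      by (rule harmonic_constant[OF _ that x]) (use Q[of 1] l1 c in simp)
    have e: "ip (\<phi> i) (\<phi> j) = \<phi> i x * \<phi> j x * vol G \<mu>"
      if "i = 0 \<or> i = 1" "j = 0 \<or> j = 1" for i j
      unfolding vinner_def vol_def sum_distrib_left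
      by (rule sum.cong) (use that c0 c1 in auto)
    have "\<phi> 0 x * \<phi> 0 x * vol G \<mu> = 1" "\<phi> 1 x * \<phi> 1 x * vol G \<mu> = 1" "\<phi> 0 x * \<phi> 1 x * vol G \<mu> = 0"
      using e[of 0 0] e[of 1 1] e[of 0 1] on c
        on[unfolded orthon_def, rule_format, OF c c]
        on[unfolded orthon_def, rule_format, of 0 1]
        on[unfolded orthon_def, rule_format, of 0 0]
      by simp_all
    then show False by auto
  qed
qed

end

end

theory Submission
  imports Defs
begin

text \<open>
  Solutions with \<open>\<integral> h e\<^sup>u d\<mu> = 1\<close> arise, after adding a constant, from critical points of
  \<open>J(u) = \<integral> \<bar>\<nabla>\<^sup>s u\<bar>\<^sup>2 d\<mu> / 2 + \<rho> / \<bar>V\<bar> \<integral> u d\<mu> - \<rho> ln (\<integral> h e\<^sup>u d\<mu>)\<close>. The first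
  integral enters only through its spectral form \<open>\<Sum>\<^sub>i lam\<^sub>i\<^sup>s \<langle>u, \<phi>\<^sub>i\<rangle>\<^sup>2\<close>. On functions of mean
  zero the quadratic term is at least \<open>lam\<^sub>1\<^sup>s / 2\<close> times the squared norm, while \<open>\<bar>ln (\<integral> h e\<^sup>u d\<mu>)\<bar>\<close>
  grows at most linearly in the norm because V is finite. So \<open>J\<close> is coercive for either sign of
  \<open>\<rho>\<close> and has a minimizer of mean zero; as \<open>J\<close> is invariant under adding constants, this is a
  minimizer among all functions, and no Lagrange multiplier appears.
\<close>

context weighted_graph
begin

section \<open>The functional and bounds on its exponential integral\<close>

text \<open>This is the pairing of u with its fractional Laplacian. The spectral form reduces
  coercivity to a termwise comparison of eigenvalues.\<close>

definition frac_energy ::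
  "(nat \<Rightarrow> real) \<Rightarrow> (nat \<Rightarrow> 'a \<Rightarrow> real) \<Rightarrow> real \<Rightarrow> ('a \<Rightarrow> real) \<Rightarrow> real" where
  "frac_energy lam \<phi> s u = (\<Sum>i<card V. lam i powr s * (ip u (\<phi> i))\<^sup>2)"

definition mean_field_functional where
  "mean_field_functional lam \<phi> s h \<rho> u = frac_energy lam \<phi> s u / 2 + \<rho> / vol G \<mu> * vint G \<mu> u
     - \<rho> * ln (vint G \<mu> (\<lambda>x. h x * exp (u x)))"

lemma V_nonempty: "V \<noteq> {}"
  using card_verts by auto

lemma vol_pos: "vol G \<mu> > 0"
  unfolding vol_def by (rule sum_pos[OF finV V_nonempty measure_pos])

lemma vint_eq_ip: "vint G \<mu> u = ip u (\<lambda>_. 1)"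
  by (simp add: vint_def vinner_def)

lemma vint_pos:
  assumes "\<forall>x\<in>V. f x \<ge> 0" "\<exists>x\<in>V. f x \<noteq> 0"
  shows "vint G \<mu> f > 0"
  unfolding vint_def
proof -
  obtain x where x: "x \<in> V" "f x \<noteq> 0" using assms(2) by blast
  show "(\<Sum>x\<in>V. \<mu> x * f x) > 0"
  proof (rule sum_pos2[OF finV x(1)])
    show "0 < \<mu> x * f x"
      using x assms(1) by (intro mult_pos_pos measure_pos) (auto simp: less_le)
    show "\<And>y. y \<in> V \<Longrightarrow> 0 \<le> \<mu> y * f y"
      using assms(1) by (intro mult_nonneg_nonneg less_imp_le[OF measure_pos]) auto
  qed
qed

lemma vint_exp_pos:
  assumes "\<forall>x\<in>V. h x \<ge> 0" "\<exists>x\<in>V. h x \<noteq> 0"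
  shows "vint G \<mu> (\<lambda>x. h x * exp (u x)) > 0"
  using assms by (intro vint_pos) auto

text \<open>On V, \<open>exp (u x)\<close> lies between \<open>exp (- M)\<close> and
  \<open>exp M\<close>, which traps the integral between multiples of \<open>vint G \<mu> h\<close>.
  Both sides matter since \<rho> may have either sign.\<close>

lemma ln_vint_exp_bound:
  assumes h: "\<forall>x\<in>V. h x \<ge> 0" "\<exists>x\<in>V. h x \<noteq> 0"
    and M: "\<And>x. x \<in> V \<Longrightarrow> \<bar>u x\<bar> \<le> M"
  shows "\<bar>ln (vint G \<mu> (\<lambda>x. h x * exp (u x)))\<bar> \<le> \<bar>ln (vint G \<mu> h)\<bar> + M"
proof -
  let ?I = "vint G \<mu> (\<lambda>x. h x * exp (u x))" and ?H = "vint G \<mu> h"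
  have H: "?H > 0" using h by (rule vint_pos)
  have I: "?I > 0" using h by (rule vint_exp_pos)
  have "?I \<le> exp M * ?H"
    unfolding vint_def sum_distrib_left
  proof (rule sum_mono)
    fix x assume x: "x \<in> V"
    have "\<mu> x * h x * exp (u x) \<le> \<mu> x * h x * exp M"
      using h(1) measure_pos[OF x] M[OF x] x by (intro mult_left_mono) auto
    then show "\<mu> x * (h x * exp (u x)) \<le> exp M * (\<mu> x * h x)" by (simp add: mult_ac)
  qed
  then have "ln ?I \<le> ln (exp M * ?H)" using H I by simp
  then have 1: "ln ?I \<le> M + ln ?H" using H by (simp add: ln_mult)
  have "exp (- M) * ?H \<le> ?I"
    unfolding vint_def sum_distrib_left
  proof (rule sum_mono)
    fix x assume x: "x \<in> V"
    have "- M \<le> u x" using M[OF x] by linarith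
    then have "\<mu> x * h x * exp (- M) \<le> \<mu> x * h x * exp (u x)"
      using h(1) measure_pos[OF x] x by (intro mult_left_mono) auto
    then show "exp (- M) * (\<mu> x * h x) \<le> \<mu> x * (h x * exp (u x))" by (simp add: mult_ac)
  qed
  then have "ln (exp (- M) * ?H) \<le> ln ?I"
    using H by (intro ln_mono) auto
  then have "- M + ln ?H \<le> ln ?I" using H by (simp add: ln_mult)
  with 1 show ?thesis by linarith
qed

section \<open>Pointwise bounds and spectral expansions\<close>

lemma abs_le_norm:
  assumes "x \<in> V"
  shows "\<bar>u x\<bar> \<le> sqrt (ip u u) / sqrt (\<mu> x)"
proof -
  have "\<mu> x * u x * u x \<le> ip u u"
    unfolding vinner_def
    by (rule member_le_sum[OF assms]) (auto simp: mult.assoc less_imp_le measure_pos)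
  then have "(u x)\<^sup>2 \<le> ip u u / \<mu> x"
    using measure_pos[OF assms] by (simp add: field_simps power2_eq_square)
  then show ?thesis
    using real_le_rsqrt[of "\<bar>u x\<bar>" "ip u u / \<mu> x"] by (simp add: real_sqrt_divide)
qed

text \<open>The difference of the two sides is orthogonal to every eigenfunction, so completeness
  makes it vanish on V.\<close>

lemma orthon_expansion:
  assumes "orthon (card V) \<phi>" "x \<in> V"
  shows "u x = (\<Sum>i<card V. ip u (\<phi> i) * \<phi> i x)"
proof -
  let ?v = "\<lambda>x. u x - (\<Sum>i<card V. ip u (\<phi> i) * \<phi> i x)"
  have "ip ?v (\<phi> j) = 0" if j: "j < card V" for j
  proof -
    have "(\<Sum>i<card V. ip u (\<phi> i) * ip (\<phi> i) (\<phi> j)) = (\<Sum>i<card V. if i = j then ip u (\<phi> i) else 0)"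
      using assms(1) j by (intro sum.cong refl) (auto simp: orthon_def)
    then show ?thesis
      unfolding ip_diff ip_sum ip_scale using j by simp
  qed
  then show ?thesis
    using orthon_complete[OF assms(1), of ?v x] assms(2) by simp
qed

lemma parseval:
  assumes "orthon (card V) \<phi>"
  shows "ip u u = (\<Sum>i<card V. (ip u (\<phi> i))\<^sup>2)"
proof -
  have "ip u u = ip (\<lambda>x. \<Sum>i<card V. ip u (\<phi> i) * \<phi> i x) u"
    by (rule ip_cong) (use orthon_expansion[OF assms] in auto)
  also have "\<dots> = (\<Sum>i<card V. (ip u (\<phi> i))\<^sup>2)"
    unfolding ip_sum ip_scale by (simp add: ip_sym[of "\<phi> _"] power2_eq_square)
  finally show ?thesis .
qed

lemma eigensystem_orthon: "eigensystem G \<mu> w lam \<phi> \<Longrightarrow> orthon (card V) \<phi>"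
  by (auto simp: eigensystem_def orthon_def)

lemma ip_L_eigenfunction:
  assumes "eigensystem G \<mu> w lam \<phi>" "i < card V"
  shows "ip (L (\<phi> i)) v = lam i * ip (\<phi> i) v"
  unfolding ip_scale[symmetric] by (rule ip_cong) (use assms in \<open>auto simp: eigensystem_def\<close>)

text \<open>Green's formula against a constant function has only zero differences. The product form
  also covers a zero eigenvalue.\<close>

lemma eigenvalue_mean_zero:
  assumes "eigensystem G \<mu> w lam \<phi>" "i < card V"
  shows "lam i * ip (\<phi> i) (\<lambda>_. 1) = 0"
  unfolding ip_L_eigenfunction[OF assms, symmetric] green by simp

text \<open>The rows of the weight matrix, diagonal included, sum to zero. Hence the
  \<open>u x\<close> part cancels and only the spectral kernel applied to u remains.\<close>

lemma frac_laplacian_spectral: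
  assumes e: "eigensystem G \<mu> w lam \<phi>" and x: "x \<in> V"
  shows "frac_laplacian G \<mu> lam \<phi> s u x = (\<Sum>i<card V. lam i powr s * ip u (\<phi> i) * \<phi> i x)"
proof -
  let ?W = "frac_weight G \<mu> lam \<phi> s"
  have W: "(\<Sum>y\<in>V. ?W x y * v y) = - (\<mu> x * (\<Sum>i<card V. lam i powr s * ip v (\<phi> i) * \<phi> i x))" for v
    unfolding frac_weight_def vinner_def sum_distrib_left sum_distrib_right sum_negf[symmetric]
    by (subst sum.swap) (intro sum.cong refl, simp)
  \<comment> \<open>If \<open>lam i = 0\<close>, the factor is \<open>0 powr s = 0\<close>;
    otherwise the eigenfunction has mean zero.\<close>
  have "lam i powr s * ip (\<lambda>_. 1) (\<phi> i) = 0" if "i < card V" for i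
    using eigenvalue_mean_zero[OF e that] by (auto simp: ip_sym)
  then have "(\<Sum>y\<in>V. ?W x y) = 0"
    using W[of "\<lambda>_. 1"] by (auto intro!: sum.neutral)
  moreover have "(\<Sum>y\<in>V - {x}. ?W x y * (u x - u y)) = (\<Sum>y\<in>V. ?W x y * (u x - u y))"
    by (rule sum.mono_neutral_left) auto
  moreover have "\<dots> = (\<Sum>y\<in>V. ?W x y) * u x - (\<Sum>y\<in>V. ?W x y * u y)"
    by (simp add: right_diff_distrib sum_subtractf sum_distrib_right)
  ultimately show ?thesis
    unfolding frac_laplacian_def using W[of u] measure_pos[OF x] by simp
qed

text \<open>A Poincare inequality: \<open>lam 0 = 0\<close> forces a constant \<phi> 0 by
  connectedness, so mean zero removes that mode, and all other eigenvalues are at least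
  \<open>lam 1\<close>.\<close>

lemma frac_energy_coercive:
  assumes e: "eigensystem G \<mu> w lam \<phi>" and s: "s \<ge> 0" and mean: "vint G \<mu> u = 0"
  shows "lam 1 powr s * ip u u \<le> frac_energy lam \<phi> s u"
proof -
  have c: "card V > 0" using card_verts by simp
  obtain x where x: "x \<in> V" using V_nonempty by blast
  have const: "\<phi> 0 y = \<phi> 0 x" if "y \<in> V" for y
    by (rule harmonic_constant[OF _ that x])
      (use ip_L_eigenfunction[OF e c] eigensystem_spectrum(1)[OF e] in simp)
  have "ip u (\<phi> 0) = \<phi> 0 x * vint G \<mu> u"
    unfolding vinner_def vint_def sum_distrib_left
    by (intro sum.cong refl) (simp add: const)
  then have u0: "ip u (\<phi> 0) = 0" using mean by simp
  show ?thesis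
    unfolding parseval[OF eigensystem_orthon[OF e]] frac_energy_def sum_distrib_left
  proof (rule sum_mono)
    fix i assume i: "i \<in> {..<card V}"
    show "lam 1 powr s * (ip u (\<phi> i))\<^sup>2 \<le> lam i powr s * (ip u (\<phi> i))\<^sup>2"
    proof (cases "i = 0")
      case False
      then have "lam 1 \<le> lam i" using e i by (auto simp: eigensystem_def)
      then show ?thesis
        using eigensystem_spectrum(2)[OF e] s by (intro mult_right_mono powr_mono2) auto
    qed (simp add: u0)
  qed
qed

section \<open>Invariance under constants and continuity\<close>

lemma frac_energy_add_const:
  assumes "eigensystem G \<mu> w lam \<phi>"
  shows "frac_energy lam \<phi> s (\<lambda>x. u x + c) = frac_energy lam \<phi> s u"
  unfolding frac_energy_def
proof (intro sum.cong refl)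
  fix i assume "i \<in> {..<card V}"
  then have "lam i = 0 \<or> ip (\<lambda>_. 1) (\<phi> i) = 0"
    using eigenvalue_mean_zero[OF assms, of i] by (auto simp: ip_sym)
  then show "lam i powr s * (ip (\<lambda>x. u x + c) (\<phi> i))\<^sup>2 = lam i powr s * (ip u (\<phi> i))\<^sup>2"
    using ip_scale[of c "\<lambda>_. 1" "\<phi> i"] by (auto simp: ip_add)
qed

lemma vint_exp_add_const:
  "vint G \<mu> (\<lambda>x. h x * exp (u x + c)) = exp c * vint G \<mu> (\<lambda>x. h x * exp (u x))"
  by (simp add: vint_def sum_distrib_left exp_add mult_ac)

lemma vint_add_const: "vint G \<mu> (\<lambda>x. u x + c) = vint G \<mu> u + c * vol G \<mu>"
  by (simp add: vint_def vol_def sum.distrib sum_distrib_left algebra_simps)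

text \<open>The linear term gains \<open>\<rho> * c\<close>, and the logarithm contributes exactly
  \<open>- \<rho> * c\<close>.\<close>

lemma mean_field_functional_add_const:
  assumes "eigensystem G \<mu> w lam \<phi>" "\<forall>x\<in>V. h x \<ge> 0" "\<exists>x\<in>V. h x \<noteq> 0"
  shows "mean_field_functional lam \<phi> s h \<rho> (\<lambda>x. u x + c) = mean_field_functional lam \<phi> s h \<rho> u"
  unfolding mean_field_functional_def frac_energy_add_const[OF assms(1)]
    vint_exp_add_const vint_add_const
  using vint_exp_pos[OF assms(2,3), of u] vol_pos
  by (simp add: ln_mult field_simps)

lemma mean_field_functional_cong:
  assumes "\<And>x. x \<in> V \<Longrightarrow> u x = v x"
  shows "mean_field_functional lam \<phi> s h \<rho> u = mean_field_functional lam \<phi> s h \<rho> v"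
proof -
  have "ip u z = ip v z" for z by (rule ip_cong) (simp_all add: assms)
  then show ?thesis
    by (simp add: mean_field_functional_def frac_energy_def vint_def assms cong: sum.cong)
qed

text \<open>Functions carry the product topology, in which evaluations are continuous;
  \<open>ln\<close> is applied only to positive integrals.\<close>

lemma continuous_mean_field_functional:
  assumes "\<forall>x\<in>V. h x \<ge> 0" "\<exists>x\<in>V. h x \<noteq> 0"
  shows "continuous_on UNIV (mean_field_functional lam \<phi> s h \<rho>)"
proof -
  have "continuous_on UNIV (\<lambda>u. vint G \<mu> (\<lambda>x. h x * exp (u x)))"
    unfolding vint_def by (intro continuous_intros) simp_all
  then have "continuous_on UNIV (\<lambda>u. ln (vint G \<mu> (\<lambda>x. h x * exp (u x))))"
    by (rule continuous_on_ln) (use vint_exp_pos[OF assms] in \<open>auto simp: less_imp_neq[symmetric]\<close>)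
  moreover have "continuous_on UNIV (\<lambda>u. frac_energy lam \<phi> s u)"
    unfolding frac_energy_def vinner_def by (intro continuous_intros) simp_all
  moreover have "continuous_on UNIV (\<lambda>u. vint G \<mu> u)"
    unfolding vint_def by (intro continuous_intros) simp_all
  ultimately show ?thesis
    unfolding mean_field_functional_def[abs_def]
    by (intro continuous_on_add continuous_on_diff continuous_on_mult_left continuous_on_divide)
      simp_all
qed

section \<open>Compactness, coercivity and the minimizer\<close>

text \<open>The vertex type may be infinite, so the set is exhibited as a closed part of a product
  of compact sets.\<close>

lemma compact_norm_ball:
  "compact {u. (\<forall>x. x \<notin> V \<longrightarrow> u x = 0) \<and> ip u u \<le> R}"
proof -
  \<comment> \<open>The half-widths come from \<open>abs_le_norm\<close>; the factor {0} off V
    encodes the vanishing condition.\<close>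
  define B where "B x = (if x \<in> V then {- (sqrt R / sqrt (\<mu> x))..sqrt R / sqrt (\<mu> x)} else {0::real})" for x
  have "compactin (product_topology (\<lambda>i. euclidean) UNIV) (PiE UNIV B)"
    unfolding compactin_PiE by (auto simp: B_def)
  then have "compact (PiE UNIV B)"
    unfolding euclidean_product_topology by simp
  moreover have "continuous_on UNIV (\<lambda>u. ip u u)"
    unfolding vinner_def by (intro continuous_intros) simp_all
  then have "closed {u. ip u u \<le> R}"
    by (intro closed_Collect_le) auto
  ultimately have "compact (PiE UNIV B \<inter> {u. ip u u \<le> R})"
    by (rule compact_Int_closed)
  moreover have "{u. (\<forall>x. x \<notin> V \<longrightarrow> u x = 0) \<and> ip u u \<le> R} = PiE UNIV B \<inter> {u. ip u u \<le> R}"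
  proof -
    have "u x \<in> B x" if u: "\<forall>x. x \<notin> V \<longrightarrow> u x = 0" "ip u u \<le> R" for u x
    proof (cases "x \<in> V")
      case True
      have "\<bar>u x\<bar> \<le> sqrt (ip u u) / sqrt (\<mu> x)" by (rule abs_le_norm[OF True])
      also have "\<dots> \<le> sqrt R / sqrt (\<mu> x)"
        using u(2) measure_pos[OF True] by (intro divide_right_mono) auto
      finally show ?thesis using True by (auto simp: B_def abs_le_iff)
    qed (use u in \<open>simp add: B_def\<close>)
    moreover have "u x = 0" if "u \<in> PiE UNIV B" "x \<notin> V" for u x
      using that PiE_mem[of u UNIV B x] by (simp add: B_def)
    ultimately show ?thesis by (auto simp: PiE_def)
  qed
  ultimately show ?thesis by simp
qed

text \<open>With N the norm of u, the energy part is at least \<open>a * N\<^sup>2 / 2\<close>,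
  while the logarithmic term is at most linear in N.\<close>

lemma mean_field_functional_coercive:
  assumes e: "eigensystem G \<mu> w lam \<phi>" and s: "s \<ge> 0"
    and h: "\<forall>x\<in>V. h x \<ge> 0" "\<exists>x\<in>V. h x \<noteq> 0"
  obtains R where "R \<ge> 0"
    "\<And>u. vint G \<mu> u = 0 \<Longrightarrow> ip u u \<ge> R \<Longrightarrow> c \<le> mean_field_functional lam \<phi> s h \<rho> u"
proof -
  define a where "a = lam 1 powr s"
  define C where "C = \<bar>ln (vint G \<mu> h)\<bar>"
  define D where "D = (\<Sum>x\<in>V. 1 / sqrt (\<mu> x))"
  \<comment> \<open>The 1 lets constants be absorbed into multiples of N; the other entry makes
    \<open>a * r / 2\<close> dominate the linear coefficient plus
    \<open>\<bar>c\<bar>\<close>.\<close>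
  define r where "r = max 1 (2 * (\<bar>\<rho>\<bar> * (C + D) + \<bar>c\<bar>) / a)"
  have a: "a > 0" using eigensystem_spectrum(2)[OF e] by (simp add: a_def)
  have C: "C \<ge> 0" by (simp add: C_def)
  have r1: "r \<ge> 1" and "r \<ge> 2 * (\<bar>\<rho>\<bar> * (C + D) + \<bar>c\<bar>) / a" by (auto simp: r_def)
  then have r2: "\<bar>\<rho>\<bar> * (C + D) + \<bar>c\<bar> \<le> a * r / 2" using a by (simp add: field_simps)
  show ?thesis
  proof (rule that[of "r\<^sup>2"])
    fix u assume m: "vint G \<mu> u = 0" and ru: "r\<^sup>2 \<le> ip u u"
    define N where "N = sqrt (ip u u)"
    have N2: "ip u u = N\<^sup>2" using ip_nonneg[of u] by (simp add: N_def)
    have N: "r \<le> N" unfolding N_def using ru by (rule real_le_rsqrt)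
    then have N1: "N \<ge> 1" using r1 by simp
    have "\<bar>u x\<bar> \<le> N * D" if x: "x \<in> V" for x
    proof -
      have "1 / sqrt (\<mu> x) \<le> D"
        unfolding D_def by (rule member_le_sum[OF x]) (auto simp: less_imp_le measure_pos)
      then have "N * (1 / sqrt (\<mu> x)) \<le> N * D" using N1 by (intro mult_left_mono) auto
      then show ?thesis using abs_le_norm[OF x, of u] by (simp add: N_def)
    qed
    then have "\<bar>ln (vint G \<mu> (\<lambda>x. h x * exp (u x)))\<bar> \<le> C + N * D"
      unfolding C_def by (rule ln_vint_exp_bound[OF h])
    also have "\<dots> \<le> N * (C + D)"
      using mult_right_mono[OF N1 C] by (simp add: algebra_simps)
    finally have "\<bar>\<rho> * ln (vint G \<mu> (\<lambda>x. h x * exp (u x)))\<bar> \<le> \<bar>\<rho>\<bar> * (N * (C + D))"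
      unfolding abs_mult by (rule mult_left_mono) simp
    then have 1: "\<rho> * ln (vint G \<mu> (\<lambda>x. h x * exp (u x))) \<le> N * (\<bar>\<rho>\<bar> * (C + D))"
      by (simp add: mult_ac)
    have 2: "a * N\<^sup>2 \<le> frac_energy lam \<phi> s u"
      using frac_energy_coercive[OF e s m] by (simp add: a_def N2)
    have "\<bar>\<rho>\<bar> * (C + D) + \<bar>c\<bar> \<le> a * N / 2"
      using r2 N a mult_left_mono[OF N, of a] by linarith
    then have "N * (\<bar>\<rho>\<bar> * (C + D) + \<bar>c\<bar>) \<le> N * (a * N / 2)"
      using N1 by (intro mult_left_mono) auto
    then have 3: "N * (\<bar>\<rho>\<bar> * (C + D)) + N * \<bar>c\<bar> \<le> a * N\<^sup>2 / 2"
      by (simp add: algebra_simps power2_eq_square)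
    have "\<bar>c\<bar> \<le> N * \<bar>c\<bar>" using mult_right_mono[OF N1, of "\<bar>c\<bar>"] by simp
    with 1 2 3 show "c \<le> mean_field_functional lam \<phi> s h \<rho> u"
      unfolding mean_field_functional_def m by simp
  qed simp
qed

lemma mean_field_functional_minimizer:
  assumes e: "eigensystem G \<mu> w lam \<phi>" and s: "s \<ge> 0"
    and h: "\<forall>x\<in>V. h x \<ge> 0" "\<exists>x\<in>V. h x \<noteq> 0"
  obtains u where "\<And>v. mean_field_functional lam \<phi> s h \<rho> u \<le> mean_field_functional lam \<phi> s h \<rho> v"
proof -
  let ?J = "mean_field_functional lam \<phi> s h \<rho>"
  \<comment> \<open>The zero function lies in the ball, so its value serves as the threshold:
    nothing of mean zero outside the ball can beat the minimum inside.\<close>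
  obtain R where R: "R \<ge> 0" "\<And>u. vint G \<mu> u = 0 \<Longrightarrow> ip u u \<ge> R \<Longrightarrow> ?J (\<lambda>_. 0) \<le> ?J u"
    using mean_field_functional_coercive[OF e s h] by blast
  define S where "S = {u. (\<forall>x. x \<notin> V \<longrightarrow> u x = 0) \<and> ip u u \<le> R} \<inter> {u. vint G \<mu> u = 0}"
  have "continuous_on UNIV (\<lambda>u. vint G \<mu> u)"
    unfolding vint_def by (intro continuous_intros) simp_all
  then have "closed {u. vint G \<mu> u = 0}" by (intro closed_Collect_eq) auto
  then have "compact S" unfolding S_def by (intro compact_Int_closed compact_norm_ball)
  moreover have z: "(\<lambda>_. 0) \<in> S" using R(1) by (simp add: S_def vint_def vinner_def)
  ultimately obtain u where u: "u \<in> S" "\<forall>v\<in>S. ?J u \<le> ?J v"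
    using continuous_attains_inf[OF _ _ continuous_on_subset[OF continuous_mean_field_functional[OF h] subset_UNIV]]
    by blast
  show ?thesis
  proof (rule that)
    fix v
    \<comment> \<open>An arbitrary competitor is shifted to mean zero and cut off outside V; neither
      change affects the functional.\<close>
    define c where "c = - (vint G \<mu> v / vol G \<mu>)"
    define v' where "v' = (\<lambda>x. if x \<in> V then v x + c else 0)"
    have "?J v' = ?J (\<lambda>x. v x + c)"
      by (rule mean_field_functional_cong) (simp add: v'_def)
    then have Jv: "?J v' = ?J v"
      by (simp add: mean_field_functional_add_const[OF e h])
    have "vint G \<mu> v' = vint G \<mu> (\<lambda>x. v x + c)" by (simp add: vint_def v'_def)
    then have m: "vint G \<mu> v' = 0" unfolding vint_add_const using vol_pos by (simp add: c_def)
    show "?J u \<le> ?J v"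
    proof (cases "ip v' v' \<le> R")
      case True
      then have "v' \<in> S" using m by (simp add: S_def v'_def)
      then show ?thesis using u(2) Jv by auto
    next
      case False
      then show ?thesis using R(2)[OF m] u(2) z Jv by fastforce
    qed
  qed
qed

section \<open>The Euler-Lagrange equation and normalization\<close>

text \<open>Varying u at the single vertex x yields the equation at x directly. Each coefficient
  \<open>ip u (\<phi> i)\<close> becomes affine in t with slope \<open>\<mu> x * \<phi> i x\<close>,
  which reproduces the spectral form of the fractional Laplacian.\<close>

lemma mean_field_functional_deriv:
  assumes e: "eigensystem G \<mu> w lam \<phi>"
    and h: "\<forall>x\<in>V. h x \<ge> 0" "\<exists>x\<in>V. h x \<noteq> 0" and x: "x \<in> V"
  shows "((\<lambda>t. mean_field_functional lam \<phi> s h \<rho> (\<lambda>y. u y + t * (if y = x then 1 else 0)))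
    has_real_derivative \<mu> x * (frac_laplacian G \<mu> lam \<phi> s u x
      - \<rho> * (h x * exp (u x) / vint G \<mu> (\<lambda>y. h y * exp (u y)) - 1 / vol G \<mu>))) (at 0)"
proof -
  let ?d = "\<lambda>y. if y = x then 1 else 0 :: real"
  let ?u = "\<lambda>t y. u y + t * ?d y"
  let ?I = "vint G \<mu> (\<lambda>y. h y * exp (u y))"
  have I: "?I > 0" using h by (rule vint_exp_pos)
  have ipu: "ip (?u t) (\<phi> i) = ip u (\<phi> i) + t * (\<mu> x * \<phi> i x)" for t i
    unfolding ip_add ip_scale ip_delta[OF x] ..
  have 1: "((\<lambda>t. frac_energy lam \<phi> s (?u t)) has_real_derivative
      2 * (\<mu> x * frac_laplacian G \<mu> lam \<phi> s u x)) (at 0)"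
    unfolding frac_energy_def ipu frac_laplacian_spectral[OF e x] sum_distrib_left
    by (auto intro!: derivative_eq_intros sum.cong)
  have vu: "vint G \<mu> (?u t) = vint G \<mu> u + t * \<mu> x" for t
    unfolding vint_eq_ip ip_add ip_scale ip_delta[OF x] by simp
  have 2: "((\<lambda>t. vint G \<mu> (?u t)) has_real_derivative \<mu> x) (at 0)"
    unfolding vu by (auto intro!: derivative_eq_intros)
  have "((\<lambda>t. vint G \<mu> (\<lambda>y. h y * exp (?u t y))) has_real_derivative
      (\<Sum>y\<in>V. \<mu> y * (h y * (?d y * exp (u y))))) (at 0)"
    unfolding vint_def by (auto intro!: derivative_eq_intros sum.cong)
  also have "(\<Sum>y\<in>V. \<mu> y * (h y * (?d y * exp (u y)))) = (\<Sum>y\<in>V. if y = x then \<mu> x * h x * exp (u x) else 0)"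
    by (intro sum.cong) auto
  finally have 3: "((\<lambda>t. vint G \<mu> (\<lambda>y. h y * exp (?u t y))) has_real_derivative
      \<mu> x * h x * exp (u x)) (at 0)"
    using x by simp
  have 4: "((\<lambda>t. ln (vint G \<mu> (\<lambda>y. h y * exp (?u t y)))) has_real_derivative
      \<mu> x * h x * exp (u x) / ?I) (at 0)"
    using DERIV_ln_divide[THEN DERIV_chain2, OF _ 3] I by simp
  show ?thesis
    unfolding mean_field_functional_def
    using DERIV_diff[OF DERIV_add[OF DERIV_cdivide[OF 1, of 2] DERIV_cmult[OF 2, of "\<rho> / vol G \<mu>"]]
        DERIV_cmult[OF 4, of \<rho>]]
    by (rule DERIV_cong) (simp add: algebra_simps)
qed

lemma frac_laplacian_add_const:
  "frac_laplacian G \<mu> lam \<phi> s (\<lambda>x. u x + c) = frac_laplacian G \<mu> lam \<phi> s u"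
  by (simp add: frac_laplacian_def fun_eq_iff)

end

theorem theorem2p3:
  fixes G :: "'a pair_pre_digraph" and \<mu> h :: "'a \<Rightarrow> real" and w :: "'a \<Rightarrow> 'a \<Rightarrow> real"
    and lam :: "nat \<Rightarrow> real" and \<phi> :: "nat \<Rightarrow> 'a \<Rightarrow> real" and \<rho> s :: real
  assumes graph: "weighted_graph G \<mu> w"
    and eigen: "eigensystem G \<mu> w lam \<phi>"
    and h_nonneg: "\<forall>x\<in>pverts G. h x \<ge> 0"
    and h_nonzero: "\<exists>x\<in>pverts G. h x \<noteq> 0"
    and rho: "\<rho> \<in> {..<0} \<union> {0<..}"
    and s: "s \<in> {0<..<1}"
  shows "\<exists>u\<in>mean_field_space G \<mu> lam \<phi> s h.
           \<forall>x\<in>pverts G. frac_laplacian G \<mu> lam \<phi> s u x =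
             \<rho> * (h x * exp (u x) / vint G \<mu> (\<lambda>y. h y * exp (u y)) - 1 / vol G \<mu>)"
proof -
  interpret weighted_graph G \<mu> w by (rule graph)
  let ?J = "mean_field_functional lam \<phi> s h \<rho>"
  obtain u where min: "\<And>v. ?J u \<le> ?J v"
    using mean_field_functional_minimizer[OF eigen _ h_nonneg h_nonzero, of s \<rho>] s by auto
  define I where "I = vint G \<mu> (\<lambda>y. h y * exp (u y))"
  have I: "I > 0" unfolding I_def using h_nonneg h_nonzero by (rule vint_exp_pos)
  have eq: "frac_laplacian G \<mu> lam \<phi> s u x = \<rho> * (h x * exp (u x) / I - 1 / vol G \<mu>)"
    if x: "x \<in> V" for x
  proof -
    have "\<mu> x * (frac_laplacian G \<mu> lam \<phi> s u x
        - \<rho> * (h x * exp (u x) / I - 1 / vol G \<mu>)) = 0"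
      unfolding I_def
      \<comment> \<open>The minimum is global, so radius 1 is an arbitrary choice.\<close>
      by (rule DERIV_local_min[OF mean_field_functional_deriv[OF eigen h_nonneg h_nonzero x] zero_less_one])
        (use min in auto)
    then show ?thesis using measure_pos[OF x] by simp
  qed
  \<comment> \<open>This shift multiplies the integral by 1/I, making it 1. The fractional Laplacian
    and the ratio of \<open>h x * exp (u x)\<close> to its integral are unchanged.\<close>
  let ?v = "\<lambda>x. u x + - ln I"
  have v: "vint G \<mu> (\<lambda>x. h x * exp (?v x)) = 1"
    unfolding vint_exp_add_const I_def[symmetric] using I by (simp add: exp_minus)
  then have "?v \<in> mean_field_space G \<mu> lam \<phi> s h"
    by (simp add: mean_field_space_def frac_sobolev_def)
  moreover have "frac_laplacian G \<mu> lam \<phi> s ?v x =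
      \<rho> * (h x * exp (?v x) / vint G \<mu> (\<lambda>y. h y * exp (?v y)) - 1 / vol G \<mu>)" if "x \<in> V" for x
    unfolding v frac_laplacian_add_const eq[OF that]
    using I by (simp add: exp_diff)
  ultimately show ?thesis by blast
qed

end
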